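(* Let $D=(V,E)$ be a digraph and let $u,v\in V$ be distinct vertices. Suppose that the arc $(u,v)$ has multiplicity $n$ and the arc $(v,u)$ has multiplicity $m$ in $E$. Let $D_3$ be the digraph obtained from $D$ by deleting all $n$ arcs $(u,v)$ and all $m$ arcs $(v,u)$. Let $D_1$ be $D_3$ with one arc $(u,v)$ added, and let $D_2$ be $D_3$ with one arc $(v,u)$ added. Then \[ \sigma(D)=n\sigma(D_1)+m\sigma(D_2)-(n+m-1)\sigma(D_3)+nm x^2 \] and \[ \pi(D)=n\pi(D_1)+m\pi(D_2)-(n+m-1)\pi(D_3). \]
   Context: Digraphs are finite directed multigraphs; loops and multiple arcs are allowed. A directed cycle of length $k\ge1$ consists of $k$ distinct vertices $v_1,\dots,v_k$ and arcs $(v_1,v_2),\dots,(v_k,v_1)$. A loop is a cycle of length 1 and two opposite arcs form a cycle of length 2. A directed path of length $k\ge1$ consists of $k+1$ distinct vertices $v_0,\dots,v_k$ and arcs $(v_0,v_1),\dots,(v_{k-1},v_k)$. Cycles and paths are counted as arc sets, so parallel arcs give different cycles and paths. The cycle polynomial is $\sigma(D;x)=\sum_{k\ge1}c_k(D)x^k$ and the path polynomial is $\pi(D;x)=\sum_{k\ge1}p_k(D)x^k$, where $c_k(D)$ and $p_k(D)$ are the numbers of directed cycles and directed paths of length $k$ in $D$. *)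

theory Defs
  imports "Graph_Theory.Graph_Theory" "HOL-Computational_Algebra.Polynomial"
begin

text \<open>
  Finite directed multigraphs (loops and parallel arcs allowed) are the digraphs of the
  locale \<^locale>\<open>fin_digraph\<close>. The library's \<^const>\<open>pre_digraph.cycle\<close> allows every length
  at least 1, and its \<^const>\<open>pre_digraph.apath\<close> is a walk with pairwise distinct vertices
  (which may be empty). Both are arc lists; a cycle has one such list for every choice of its
  starting vertex, so it is the arc sets that are counted.
\<close>

definition cycles_of_length :: "('a,'b) pre_digraph \<Rightarrow> nat \<Rightarrow> 'b set set" where
  "cycles_of_length D k = {set p | p. pre_digraph.cycle D p \<and> length p = k}"

definition paths_of_length :: "('a,'b) pre_digraph \<Rightarrow> nat \<Rightarrow> 'b set set" where
  "paths_of_length D k = {set p | p. (\<exists>u v. pre_digraph.apath D u p v) \<and> length p = k}"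

text \<open>
  In a finite digraph no cycle or path is longer than the number of vertices, so the sums over
  all \<open>k \<ge> 1\<close> may be cut off there; see \<open>coeff_cycle_poly\<close> and \<open>coeff_path_poly\<close> below.
\<close>

definition cycle_poly :: "('a,'b) pre_digraph \<Rightarrow> int poly" where
  "cycle_poly D = (\<Sum>k = 1..card (verts D). monom (int (card (cycles_of_length D k))) k)"

definition path_poly :: "('a,'b) pre_digraph \<Rightarrow> int poly" where
  "path_poly D = (\<Sum>k = 1..card (verts D). monom (int (card (paths_of_length D k))) k)"

definition parallel_arcs :: "('a,'b) pre_digraph \<Rightarrow> 'a \<Rightarrow> 'a \<Rightarrow> 'b set" where
  "parallel_arcs D u v = {a \<in> arcs D. tail D a = u \<and> head D a = v}"

definition arc_mult :: "('a,'b) pre_digraph \<Rightarrow> 'a \<Rightarrow> 'a \<Rightarrow> nat" where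
  "arc_mult D u v = card (parallel_arcs D u v)"

definition del_arcs :: "('a,'b) pre_digraph \<Rightarrow> 'b set \<Rightarrow> ('a,'b) pre_digraph" where
  "del_arcs D A = D\<lparr>arcs := arcs D - A\<rparr>"

text \<open>
  Adds \<open>a\<close> as an arc from \<open>u\<close> to \<open>v\<close>; meant for \<open>a \<notin> arcs D\<close> and vertices \<open>u\<close>, \<open>v\<close> of \<open>D\<close>.
  In contrast to \<^const>\<open>pre_digraph.add_arc\<close>, the ends of \<open>a\<close> are prescribed instead of being
  read off from the values of \<^const>\<open>tail\<close> and \<^const>\<open>head\<close> outside \<open>arcs D\<close>.
\<close>

definition add_arc_between :: "('a,'b) pre_digraph \<Rightarrow> 'b \<Rightarrow> 'a \<Rightarrow> 'a \<Rightarrow> ('a,'b) pre_digraph" where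
  "add_arc_between D a u v =
     D\<lparr>arcs := insert a (arcs D), tail := (tail D)(a := u), head := (head D)(a := v)\<rparr>"

lemma (in fin_digraph) length_cycle_le:
  assumes "cycle p"
  shows "length p \<le> card (verts G)"
proof -
  obtain u where u: "awalk u p u" "distinct (tl (awalk_verts u p))"
    using assms unfolding cycle_def by blast
  have "set (tl (awalk_verts u p)) \<subseteq> verts G"
    using u(1) unfolding awalk_conv by (meson list.set_sel(2) awalk_verts_non_Nil subset_iff)
  then have "card (set (tl (awalk_verts u p))) \<le> card (verts G)"
    by (intro card_mono) auto
  then show ?thesis
    using distinct_card[OF u(2)] by (simp add: length_awalk_verts)
qed

lemma coeff_sum_monom_interval:
  "coeff (\<Sum>k = 1..N. monom (f k) k) i = (if 1 \<le> i \<and> i \<le> N then f i else (0::int))"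
  by (auto simp: coeff_sum)

lemma coeff_cycle_poly:
  assumes "fin_digraph D"
  shows "coeff (cycle_poly D) k = (if k = 0 then 0 else int (card (cycles_of_length D k)))"
proof -
  have "cycles_of_length D k = {}" if "k > card (verts D)"
    using fin_digraph.length_cycle_le[OF assms] that
    by (fastforce simp: cycles_of_length_def)
  then show ?thesis
    unfolding cycle_poly_def coeff_sum_monom_interval by auto
qed

lemma coeff_path_poly:
  assumes "fin_digraph D"
  shows "coeff (path_poly D) k = (if k = 0 then 0 else int (card (paths_of_length D k)))"
proof -
  have "paths_of_length D k = {}" if "k > card (verts D)"
    using fin_digraph.length_apath[OF assms] that
    by (fastforce simp: paths_of_length_def)
  then show ?thesis
    unfolding path_poly_def coeff_sum_monom_interval by auto
qed

end

theory Submission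
  imports Defs
begin

text \<open>
  Heads of arcs are distinct along a cycle or path, so its arc set contains at most one arc
  \<open>(u,v)\<close> and at most one arc \<open>(v,u)\<close>. The arc sets avoiding all these arcs are those of \<open>D3\<close>.
  The arc sets containing exactly one given arc \<open>a\<close> among them correspond, by replacing \<open>a\<close>,
  to those of \<open>D1\<close> or \<open>D2\<close> that use the added arc. An arc set containing both an arc
  \<open>(u,v)\<close> and an arc \<open>(v,u)\<close> is a cycle of length 2, and there are \<open>nm\<close> of these.
\<close>

section \<open>Finiteness of digraphs after deleting or adding arcs\<close>

lemma wf_digraph_del_arcs:
  assumes "wf_digraph D"
  shows "wf_digraph (del_arcs D A)"
  using assms by (auto simp: wf_digraph_def del_arcs_def)

lemma fin_digraph_del_arcs:
  assumes "fin_digraph D"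
  shows "fin_digraph (del_arcs D A)"
  using assms
  by (auto simp: fin_digraph_def fin_digraph_axioms_def wf_digraph_del_arcs) (auto simp: del_arcs_def)

lemma fin_digraph_add_arc_between:
  assumes "fin_digraph D" "u \<in> verts D" "v \<in> verts D"
  shows "fin_digraph (add_arc_between D a u v)"
  using assms
  by (auto simp: fin_digraph_def fin_digraph_axioms_def wf_digraph_def add_arc_between_def)

section \<open>Transport of walks along maps of arcs that keep both ends\<close>

lemma awalk_map:
  assumes "pre_digraph.awalk G u p v" "verts G = verts H"
    and "\<And>x. x \<in> set p \<Longrightarrow> f x \<in> arcs H \<and> tail H (f x) = tail G x \<and> head H (f x) = head G x"
  shows "pre_digraph.awalk H u (map f p) v"
proof -
  have "pre_digraph.cas H u (map f p) v" if "pre_digraph.cas G u p v"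
    using that assms(3) by (induction p arbitrary: u) (auto simp: pre_digraph.cas.simps)
  then show ?thesis
    using assms by (auto simp: pre_digraph.awalk_def)
qed

text \<open>\<open>awalk_verts\<close> reads nothing but the ends of the arcs. Distinctness of
  vertices, the condition that singles out cycles and paths among walks, is therefore transported
  too.\<close>

lemma awalk_verts_map:
  assumes "\<And>x. x \<in> set p \<Longrightarrow> tail H (f x) = tail G x \<and> head H (f x) = head G x"
  shows "pre_digraph.awalk_verts H u (map f p) = pre_digraph.awalk_verts G u p"
  using assms by (induction p arbitrary: u) (auto simp: pre_digraph.awalk_verts.simps)

text \<open>Behind its first entry, the vertex list of a walk consists of the heads of its arcs.
  Asking for distinctness only there covers cycles, which return to their first vertex, as well as
  paths.\<close>

lemma (in pre_digraph) distinct_heads: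
  assumes "awalk u p v" "distinct (tl (awalk_verts u p))"
  shows "distinct (map (head G) p)"
  using assms by (cases "p = []") (auto simp: awalk_def awalk_verts_conv')

section \<open>Counting in an abstract family of arc sets\<close>

text \<open>Collects what the counting uses about cycles and paths, so that it is done once for
  both. In \<open>image_in\<close> the map \<open>f\<close> is automatically injective on
  \<open>S\<close>, because it keeps heads and these are distinct on \<open>S\<close>; hence an
  index \<open>k\<close> measuring size can be preserved.\<close>

locale arc_set_family =
  fixes F :: "('a,'b) pre_digraph \<Rightarrow> nat \<Rightarrow> 'b set set"
  assumes arcs_of_member: "S \<in> F G k \<Longrightarrow> S \<subseteq> arcs G"
    and inj_on_head: "S \<in> F G k \<Longrightarrow> inj_on (head G) S"
    and image_in: "\<lbrakk>S \<in> F G k; verts G = verts H;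
        \<And>x. x \<in> S \<Longrightarrow> f x \<in> arcs H \<and> tail H (f x) = tail G x \<and> head H (f x) = head G x\<rbrakk>
      \<Longrightarrow> f ` S \<in> F H k"
begin

lemma finite_family:
  assumes "fin_digraph G"
  shows "finite (F G k)"
proof (rule finite_subset)
  show "F G k \<subseteq> Pow (arcs G)"
    using arcs_of_member by blast
  show "finite (Pow (arcs G))"
    using assms by (simp add: fin_digraph.finite_arcs)
qed

text \<open>Deletion changes neither the vertices nor the ends of arcs, so both inclusions are
  \<open>image_in\<close> for the identity map.\<close>

lemma family_del_arcs: "F (del_arcs D M) k = {S \<in> F D k. S \<inter> M = {}}"
proof (intro equalityI subsetI)
  fix S assume S: "S \<in> F (del_arcs D M) k"
  have "id ` S \<in> F D k"
    by (rule image_in[OF S]) (use arcs_of_member[OF S] in \<open>auto simp: del_arcs_def\<close>)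
  then show "S \<in> {S \<in> F D k. S \<inter> M = {}}"
    using arcs_of_member[OF S] by (auto simp: del_arcs_def)
next
  fix S assume S: "S \<in> {S \<in> F D k. S \<inter> M = {}}"
  then have "id ` S \<in> F (del_arcs D M) k"
    by (intro image_in[of S D]) (use arcs_of_member[of S D k] in \<open>auto simp: del_arcs_def\<close>)
  then show "S \<in> F (del_arcs D M) k" by simp
qed

text \<open>The ends are redefined at \<open>a\<close> only, and \<open>a\<close> is not an old arc,
  so the identity map again works in both directions.\<close>

lemma family_add_arc_avoiding:
  assumes "a \<notin> arcs D"
  shows "{S \<in> F (add_arc_between D a u v) k. a \<notin> S} = F D k"
proof (intro equalityI subsetI)
  fix S assume S: "S \<in> {S \<in> F (add_arc_between D a u v) k. a \<notin> S}"
  then have "id ` S \<in> F D k"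
    by (intro image_in[of S "add_arc_between D a u v"])
      (use arcs_of_member[of S "add_arc_between D a u v" k] in \<open>auto simp: add_arc_between_def\<close>)
  then show "S \<in> F D k" by simp
next
  fix S assume S: "S \<in> F D k"
  have "id ` S \<in> F (add_arc_between D a u v) k"
    by (rule image_in[OF S])
      (use arcs_of_member[OF S] assms in \<open>auto simp: add_arc_between_def\<close>)
  then show "S \<in> {S \<in> F (add_arc_between D a u v) k. a \<notin> S}"
    using arcs_of_member[OF S] assms by auto
qed

text \<open>Exchanging \<open>a\<close> for \<open>b\<close> is a bijection. The new arc
  \<open>b\<close> only has to differ from the surviving arcs; it may be one of the deleted ones,
  even \<open>a\<close> itself.\<close>

lemma card_family_replace_arc:
  assumes "a \<in> arcs D" "a \<in> M" "b \<notin> arcs D - M"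
    and D1: "D1 = add_arc_between (del_arcs D M) b (tail D a) (head D a)"
  shows "card {S \<in> F D k. S \<inter> M = {a}} = card {S \<in> F D1 k. b \<in> S}"
proof -
  \<comment> \<open>These are not transpositions: \<open>f\<close> sends both \<open>a\<close> and
    \<open>b\<close> to \<open>b\<close>, and \<open>g\<close> sends both to \<open>a\<close>. They
    are mutually inverse on the two families, since a member on the left contains \<open>b\<close>
    only if \<open>b = a\<close>, and \<open>a\<close> is an arc of \<open>D1\<close> only if
    \<open>a = b\<close>.\<close>
  define f where "f = (\<lambda>x. if x = a then b else x)"
  define g where "g = (\<lambda>x. if x = b then a else x)"
  have "bij_betw ((`) f) {S \<in> F D k. S \<inter> M = {a}} {S \<in> F D1 k. b \<in> S}"
  proof (rule bij_betw_byWitness[where f' = "(`) g"])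
    show "\<forall>S \<in> {S \<in> F D k. S \<inter> M = {a}}. g ` f ` S = S"
    proof
      fix S assume S: "S \<in> {S \<in> F D k. S \<inter> M = {a}}"
      then have "g (f x) = x" if "x \<in> S" for x
        using that arcs_of_member[of S D k] assms(3) by (auto simp: f_def g_def)
      then show "g ` f ` S = S" by (force simp: image_image)
    qed
    show "\<forall>S \<in> {S \<in> F D1 k. b \<in> S}. f ` g ` S = S"
    proof
      fix S assume S: "S \<in> {S \<in> F D1 k. b \<in> S}"
      then have "f (g x) = x" if "x \<in> S" for x
        using that arcs_of_member[of S D1 k] assms(2)
        by (auto simp: f_def g_def D1 add_arc_between_def del_arcs_def)
      then show "f ` g ` S = S" by (force simp: image_image)
    qed
    show "(`) f ` {S \<in> F D k. S \<inter> M = {a}} \<subseteq> {S \<in> F D1 k. b \<in> S}"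
    proof clarify
      fix S assume S: "S \<in> F D k" "S \<inter> M = {a}"
      have "f ` S \<in> F D1 k"
      proof (rule image_in[OF S(1)])
        fix x assume "x \<in> S"
        then show "f x \<in> arcs D1 \<and> tail D1 (f x) = tail D x \<and> head D1 (f x) = head D x"
          using arcs_of_member[OF S(1)] S(2) assms(3)
          by (auto simp: f_def D1 add_arc_between_def del_arcs_def)
      qed (simp add: D1 add_arc_between_def del_arcs_def)
      moreover have "b \<in> f ` S" using S(2) by (force simp: f_def)
      ultimately show "f ` S \<in> F D1 k \<and> b \<in> f ` S" by blast
    qed
    show "(`) g ` {S \<in> F D1 k. b \<in> S} \<subseteq> {S \<in> F D k. S \<inter> M = {a}}"
    proof clarify
      fix S assume S: "S \<in> F D1 k" "b \<in> S"
      have arcs: "S \<subseteq> insert b (arcs D - M)"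
        using arcs_of_member[OF S(1)] by (simp add: D1 add_arc_between_def del_arcs_def)
      have "g ` S \<in> F D k"
      proof (rule image_in[OF S(1)])
        fix x assume "x \<in> S"
        then show "g x \<in> arcs D \<and> tail D (g x) = tail D1 x \<and> head D (g x) = head D1 x"
          using arcs assms(1) by (auto simp: g_def D1 add_arc_between_def del_arcs_def)
      qed (simp add: D1 add_arc_between_def del_arcs_def)
      moreover have "g ` S \<inter> M = {a}" using arcs S(2) assms(2) by (force simp: g_def)
      ultimately show "g ` S \<in> F D k \<and> g ` S \<inter> M = {a}" by blast
    qed
  qed
  then show ?thesis by (rule bij_betw_same_card)
qed

text \<open>Members of \<open>F D1 k\<close> that avoid \<open>b\<close> are the members of
  \<open>F (del_arcs D M) k\<close>, so a difference counts those that use it. It depends on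
  \<open>a\<close> only through its ends, which later yields the factors \<open>n\<close> and
  \<open>m\<close>.\<close>

lemma card_family_single_arc:
  assumes "fin_digraph D" "a \<in> arcs D" "a \<in> M" "b \<notin> arcs D - M"
    and D1: "D1 = add_arc_between (del_arcs D M) b (tail D a) (head D a)"
  shows "int (card {S \<in> F D k. S \<inter> M = {a}})
    = int (card (F D1 k)) - int (card (F (del_arcs D M) k))"
proof -
  have "fin_digraph D1"
    unfolding D1 using assms(1,2)
    by (intro fin_digraph_add_arc_between fin_digraph_del_arcs)
      (auto simp: del_arcs_def fin_digraph_def wf_digraph_def)
  then have fin: "finite (F D1 k)" by (rule finite_family)
  have avoid: "{S \<in> F D1 k. b \<notin> S} = F (del_arcs D M) k"
    unfolding D1 by (rule family_add_arc_avoiding) (use assms(4) in \<open>simp add: del_arcs_def\<close>)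
  have "F D1 k = {S \<in> F D1 k. b \<in> S} \<union> {S \<in> F D1 k. b \<notin> S}" by blast
  also have "card \<dots> = card {S \<in> F D1 k. b \<in> S} + card {S \<in> F D1 k. b \<notin> S}"
    using fin by (intro card_Un_disjoint) auto
  finally show ?thesis
    unfolding avoid card_family_replace_arc[OF assms(2-5)] by simp
qed

text \<open>The sets avoiding \<open>A \<union> B\<close> contribute \<open>F D3 k\<close> once, and
  each arc of \<open>A\<close> or \<open>B\<close> subtracts it once; this explains the coefficient
  of \<open>F D3 k\<close>. The last summand stays unevaluated because cycles and paths differ
  there.\<close>

lemma card_family_multiple_arcs:
  assumes "fin_digraph D" "u \<noteq> v"
    and A: "A = parallel_arcs D u v" and B: "B = parallel_arcs D v u"
    and D3: "D3 = del_arcs D (A \<union> B)"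
    and "a1 \<notin> arcs D3" and D1: "D1 = add_arc_between D3 a1 u v"
    and "a2 \<notin> arcs D3" and D2: "D2 = add_arc_between D3 a2 v u"
  shows "int (card (F D k)) = int (card A) * int (card (F D1 k)) + int (card B) * int (card (F D2 k))
    - (int (card A) + int (card B) - 1) * int (card (F D3 k))
    + int (card {S \<in> F D k. S \<inter> A \<noteq> {} \<and> S \<inter> B \<noteq> {}})"
proof -
  define X where "X = (\<lambda>a. {S \<in> F D k. S \<inter> (A \<union> B) = {a}})"
  define E where "E = {S \<in> F D k. S \<inter> A \<noteq> {} \<and> S \<inter> B \<noteq> {}}"
  have fin: "finite (F D k)" using assms(1) by (rule finite_family)
  have finAB: "finite A" "finite B"
    using assms(1) by (simp_all add: A B parallel_arcs_def fin_digraph.finite_arcs)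
  have disj: "A \<inter> B = {}" using assms(2) by (auto simp: A B parallel_arcs_def)
  have X: "int (card (X a)) = int (card (F D1 k)) - int (card (F D3 k))" if "a \<in> A" for a
    unfolding X_def D3
    by (rule card_family_single_arc[where b = a1])
      (use that assms in \<open>auto simp: parallel_arcs_def del_arcs_def\<close>)
  have X': "int (card (X a)) = int (card (F D2 k)) - int (card (F D3 k))" if "a \<in> B" for a
    unfolding X_def D3
    by (rule card_family_single_arc[where b = a2])
      (use that assms in \<open>auto simp: parallel_arcs_def del_arcs_def\<close>)
  have one: "S \<inter> A = {a}" if "S \<in> F D k" "a \<in> S" "a \<in> A" for S a
    using inj_on_head[OF that(1)] that by (auto simp: A parallel_arcs_def inj_on_def)
  have one': "S \<inter> B = {a}" if "S \<in> F D k" "a \<in> S" "a \<in> B" for S a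
    using inj_on_head[OF that(1)] that by (auto simp: B parallel_arcs_def inj_on_def)
  have X_E: "S \<notin> E" if "S \<in> X a" for S a
  proof
    assume "S \<in> E"
    then obtain x y where xy: "x \<in> S \<inter> A" "y \<in> S \<inter> B" by (auto simp: E_def)
    moreover have "S \<inter> (A \<union> B) = {a}" using that by (simp add: X_def)
    ultimately have "x = a" "y = a" by blast+
    then show False using xy disj by blast
  qed
  have "F D k = F D3 k \<union> (\<Union>a \<in> A \<union> B. X a) \<union> E"
  proof (intro equalityI subsetI)
    fix S assume S: "S \<in> F D k"
    consider "S \<inter> (A \<union> B) = {}" | a where "a \<in> S" "a \<in> A" "S \<inter> B = {}"
      | a where "a \<in> S" "a \<in> B" "S \<inter> A = {}" | "S \<inter> A \<noteq> {}" "S \<inter> B \<noteq> {}"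
      by blast
    then show "S \<in> F D3 k \<union> (\<Union>a \<in> A \<union> B. X a) \<union> E"
    proof cases
      case 1
      then show ?thesis using S by (simp add: D3 family_del_arcs)
    next
      case (2 a)
      then have "S \<in> X a" using S one[OF S] by (simp add: X_def Int_Un_distrib)
      then show ?thesis using 2 by blast
    next
      case (3 a)
      then have "S \<in> X a" using S one'[OF S] by (simp add: X_def Int_Un_distrib)
      then show ?thesis using 3 by blast
    next
      case 4
      then show ?thesis using S by (simp add: E_def)
    qed
  qed (auto simp: D3 family_del_arcs X_def E_def)
  also have "card \<dots> = card (F D3 k) + card (\<Union>a \<in> A \<union> B. X a) + card E"
  proof (subst card_Un_disjoint)
    show "(F D3 k \<union> (\<Union>a \<in> A \<union> B. X a)) \<inter> E = {}"
      using X_E by (auto simp: D3 family_del_arcs) (auto simp: E_def)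
    show "card (F D3 k \<union> (\<Union>a \<in> A \<union> B. X a)) + card E
        = card (F D3 k) + card (\<Union>a \<in> A \<union> B. X a) + card E"
      using fin finAB
      by (subst card_Un_disjoint) (auto simp: D3 family_del_arcs X_def)
  qed (use fin finAB in \<open>auto simp: D3 family_del_arcs X_def E_def\<close>)
  \<comment> \<open>The sets \<open>X a\<close> are pairwise disjoint, as the intersection of
    \<open>S\<close> with \<open>A \<union> B\<close> determines \<open>a\<close>.\<close>
  also have "card (\<Union>a \<in> A \<union> B. X a) = (\<Sum>a \<in> A \<union> B. card (X a))"
    using fin finAB by (intro card_UN_disjoint) (auto simp: X_def)
  also have "\<dots> = (\<Sum>a \<in> A. card (X a)) + (\<Sum>a \<in> B. card (X a))"
    using finAB disj by (intro sum.union_disjoint)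
  finally have "int (card (F D k)) = int (card (F D3 k)) + (\<Sum>a \<in> A. int (card (X a)))
      + (\<Sum>a \<in> B. int (card (X a))) + int (card E)"
    by simp
  moreover have "(\<Sum>a \<in> A. int (card (X a)))
      = int (card A) * (int (card (F D1 k)) - int (card (F D3 k)))"
    using X by simp
  moreover have "(\<Sum>a \<in> B. int (card (X a)))
      = int (card B) * (int (card (F D2 k)) - int (card (F D3 k)))"
    using X' by simp
  ultimately show ?thesis
    unfolding E_def by (simp add: algebra_simps)
qed

end

section \<open>Cycles and paths as instances of the abstract family\<close>

interpretation cycles: arc_set_family cycles_of_length
proof
  fix G :: "('a,'b) pre_digraph" and S k
  assume "S \<in> cycles_of_length G k"
  then obtain p where p: "S = set p" "pre_digraph.cycle G p" "length p = k"
    by (auto simp: cycles_of_length_def)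
  then obtain u where u: "pre_digraph.awalk G u p u"
    "distinct (tl (pre_digraph.awalk_verts G u p))" "p \<noteq> []"
    by (auto simp: pre_digraph.cycle_def)
  show "S \<subseteq> arcs G" using u(1) p(1) by (simp add: pre_digraph.awalk_def)
  show "inj_on (head G) S"
    using pre_digraph.distinct_heads[OF u(1,2)] p(1) by (simp add: distinct_map)
  fix H :: "('a,'b) pre_digraph" and f
  assume "verts G = verts H"
    and f: "\<And>x. x \<in> S \<Longrightarrow> f x \<in> arcs H \<and> tail H (f x) = tail G x \<and> head H (f x) = head G x"
  then have "pre_digraph.awalk H u (map f p) u"
    using u(1) p(1) by (intro awalk_map) auto
  moreover have "pre_digraph.awalk_verts H u (map f p) = pre_digraph.awalk_verts G u p"
    using f p(1) by (intro awalk_verts_map) auto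
  ultimately have "pre_digraph.cycle H (map f p)"
    using u by (auto simp: pre_digraph.cycle_def)
  then show "f ` S \<in> cycles_of_length H k"
    unfolding cycles_of_length_def using p by (intro CollectI exI[of _ "map f p"]) auto
qed

interpretation paths: arc_set_family paths_of_length
proof
  fix G :: "('a,'b) pre_digraph" and S k
  assume "S \<in> paths_of_length G k"
  then obtain p u v where p: "S = set p" "length p = k" "pre_digraph.awalk G u p v"
    "distinct (pre_digraph.awalk_verts G u p)"
    by (auto simp: paths_of_length_def pre_digraph.apath_def)
  show "S \<subseteq> arcs G" using p by (simp add: pre_digraph.awalk_def)
  show "inj_on (head G) S"
    using pre_digraph.distinct_heads[OF p(3)] p(1,4) by (simp add: distinct_map distinct_tl)
  fix H :: "('a,'b) pre_digraph" and f
  assume "verts G = verts H"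
    and f: "\<And>x. x \<in> S \<Longrightarrow> f x \<in> arcs H \<and> tail H (f x) = tail G x \<and> head H (f x) = head G x"
  then have "pre_digraph.awalk H u (map f p) v"
    using p by (intro awalk_map) auto
  moreover have "pre_digraph.awalk_verts H u (map f p) = pre_digraph.awalk_verts G u p"
    using f p(1) by (intro awalk_verts_map) auto
  ultimately have "pre_digraph.apath H u (map f p) v"
    using p by (auto simp: pre_digraph.apath_def)
  then show "f ` S \<in> paths_of_length H k"
    unfolding paths_of_length_def using p by (intro CollectI exI[of _ "map f p"]) auto
qed

section \<open>Opposite arcs on a path or a cycle\<close>

context wf_digraph
begin

text \<open>Whichever of two opposite arcs comes first, its tail is the head of the later one, so
  the walk returns to a vertex.\<close>

lemma apath_not_opposite:
  assumes "apath w p z" "a \<in> set p" "b \<in> set p" "tail G b = head G a"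
  shows "tail G a \<noteq> head G b"
proof
  assume eq: "tail G a = head G b"
  have no_return: False
    if p: "p = p1 @ x # p2 @ y # p3" and xy: "tail G x = head G y" for p1 p2 p3 x y
  proof -
    have "apath (awlast w p1) (x # p2 @ y # p3) z"
      using assms(1) unfolding p apath_append_iff by simp
    then have "distinct (awalk_verts (awlast w p1) (x # p2 @ y # p3))"
      and cas: "cas (awlast w p1) (x # p2 @ y # p3) z"
      by (auto simp: apath_def awalk_def)
    \<comment> \<open>The vertex list of this subpath starts with \<open>tail G x\<close> and
      contains \<open>head G y\<close> further on.\<close>
    then show False
      using xy by (subst (asm) awalk_verts_conv'[OF cas]) auto
  qed
  \<comment> \<open>If \<open>a\<close> and \<open>b\<close> coincided, \<open>a\<close> would be a
    loop.\<close>
  have "a \<noteq> b" using no_loops_in_apath[OF assms(1,2)] eq by auto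
  obtain r s where rs: "p = r @ a # s" using assms(2) by (meson split_list)
  then have "b \<in> set r \<or> b \<in> set s" using assms(3) \<open>a \<noteq> b\<close> by auto
  then show False
  proof
    assume "b \<in> set r"
    then obtain r1 r2 where "r = r1 @ b # r2" by (meson split_list)
    then show False using no_return[of r1 b r2 a s] rs assms(4) by simp
  next
    assume "b \<in> set s"
    then obtain s1 s2 where "s = s1 @ b # s2" by (meson split_list)
    then show False using no_return[of r a s1 b s2] rs eq by simp
  qed
qed

text \<open>The cycle without \<open>a\<close> is a walk from the head of \<open>a\<close> to its
  tail. The arc \<open>b\<close> cuts it into two closed walks, and both are empty because heads do
  not repeat on a cycle.\<close>

lemma cycle_opposite_arcs:
  assumes "cycle p" "a \<in> set p" "b \<in> set p" "tail G b = head G a" "tail G a = head G b"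
    and "tail G a \<noteq> head G a"
  shows "set p = {a, b}" "length p = 2"
proof -
  obtain w where w: "awalk w p w" "distinct (tl (awalk_verts w p))"
    using assms(1) by (auto simp: cycle_def)
  have dist: "distinct (map (head G) p)" using distinct_heads[OF w] .
  obtain r s where rs: "p = r @ a # s" using assms(2) by (meson split_list)
  \<comment> \<open>Rotation: \<open>s @ r\<close> is the rest of the cycle, read from the head of
    \<open>a\<close> onwards.\<close>
  have walk: "awalk (head G a) (s @ r) (tail G a)"
    using w(1) unfolding rs by (auto simp: awalk_simps)
  have "a \<noteq> b" using assms(5,6) by auto
  then have "b \<in> set (s @ r)" using assms(3) rs by auto
  then obtain q1 q2 where q: "s @ r = q1 @ b # q2" by (meson split_list)
  have heads: "distinct (map (head G) (a # q1 @ b # q2))"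
    using dist unfolding q[symmetric] rs by auto
  have "awalk (head G a) q1 (head G a)" "awalk (head G b) q2 (head G b)"
    using walk assms(4,5) unfolding q by (auto simp: awalk_simps)
  \<comment> \<open>The last arc of a nonempty closed walk has the starting vertex as its head. Here
    that vertex is already the head of \<open>a\<close> or of \<open>b\<close>.\<close>
  have nil: "q' = []" if "awalk x q' x" "x \<notin> head G ` set q'" for q' x
  proof (rule ccontr)
    assume "q' \<noteq> []"
    moreover from that(1) have "awlast x q' = x" by auto
    ultimately have "head G (last q') = x" by (simp add: awalk_verts_conv)
    then show False using that(2) \<open>q' \<noteq> []\<close> by force
  qed
  have "q1 = []" by (rule nil) (fact, use heads in auto)
  moreover have "q2 = []" by (rule nil) (fact, use heads in auto)
  ultimately have sr: "s @ r = [b]" using q by simp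
  then have "set (s @ r) = {b}" "length (s @ r) = 1" by simp_all
  then show "set p = {a, b}" "length p = 2"
    unfolding rs by auto
qed

lemma cycle_pair:
  assumes "a \<in> arcs G" "b \<in> arcs G" "tail G b = head G a" "tail G a = head G b"
    and "tail G a \<noteq> head G a"
  shows "cycle [a, b]"
  unfolding cycle_def using assms by (intro exI[of _ "tail G a"]) (auto simp: awalk_simps)

end

text \<open>The cycles in question are the sets \<open>{a, b}\<close> with \<open>a\<close> from
  \<open>u\<close> to \<open>v\<close> and \<open>b\<close> from \<open>v\<close> to
  \<open>u\<close>. As \<open>u \<noteq> v\<close>, such a set determines the ordered pair, so the
  product of the two arc classes counts them.\<close>

lemma card_cycles_opposite:
  assumes "wf_digraph D" "u \<noteq> v"
  shows "card {S \<in> cycles_of_length D k. S \<inter> parallel_arcs D u v \<noteq> {} \<and> S \<inter> parallel_arcs D v u \<noteq> {}}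
    = (if k = 2 then arc_mult D u v * arc_mult D v u else 0)"
proof -
  interpret wf_digraph D by fact
  let ?A = "parallel_arcs D u v" and ?B = "parallel_arcs D v u"
  let ?E = "{S \<in> cycles_of_length D k. S \<inter> ?A \<noteq> {} \<and> S \<inter> ?B \<noteq> {}}"
  have E: "k = 2 \<and> (\<exists>a \<in> ?A. \<exists>b \<in> ?B. S = {a, b})" if "S \<in> ?E" for S
  proof -
    obtain p a b where "cycle p" "S = set p" "length p = k" "a \<in> set p" "b \<in> set p"
      "a \<in> ?A" "b \<in> ?B"
      using \<open>S \<in> ?E\<close> by (auto simp: cycles_of_length_def)
    moreover from this have "set p = {a, b}" "length p = 2"
      using cycle_opposite_arcs[of p a b] \<open>u \<noteq> v\<close> by (auto simp: parallel_arcs_def)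
    ultimately show ?thesis by blast
  qed
  show ?thesis
  proof (cases "k = 2")
    case True
    have "{a, b} \<in> ?E" if ab: "a \<in> ?A" "b \<in> ?B" for a b
    proof -
      have "cycle [a, b]"
        using ab \<open>u \<noteq> v\<close> by (intro cycle_pair) (auto simp: parallel_arcs_def)
      then have "set [a, b] \<in> cycles_of_length D k"
        unfolding cycles_of_length_def True by (intro CollectI exI[of _ "[a, b]"]) simp
      then show ?thesis using ab by auto
    qed
    then have "?E = (\<lambda>(a, b). {a, b}) ` (?A \<times> ?B)"
      using E by fastforce
    moreover have "inj_on (\<lambda>(a, b). {a, b}) (?A \<times> ?B)"
      using \<open>u \<noteq> v\<close> by (auto simp: inj_on_def parallel_arcs_def doubleton_eq_iff)
    ultimately show ?thesis
      using True by (simp add: card_image card_cartesian_product arc_mult_def)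
  next
    case False
    then have "?E = {}" using E by blast
    then show ?thesis using False by (simp only: card.empty if_False)
  qed
qed

text \<open>By \<open>apath_not_opposite\<close>; this is why the path identity has no quadratic
  extra term.\<close>

lemma paths_opposite_empty:
  assumes "wf_digraph D"
  shows "{S \<in> paths_of_length D k. S \<inter> parallel_arcs D u v \<noteq> {} \<and> S \<inter> parallel_arcs D v u \<noteq> {}} = {}"
proof -
  have False if "S \<in> paths_of_length D k" "a \<in> S" "a \<in> parallel_arcs D u v"
    "b \<in> S" "b \<in> parallel_arcs D v u" for S a b
  proof -
    obtain p w z where "pre_digraph.apath D w p z" "S = set p"
      using \<open>S \<in> paths_of_length D k\<close> by (auto simp: paths_of_length_def)
    then show False
      using wf_digraph.apath_not_opposite[OF assms, of w p z a b] that
      by (simp add: parallel_arcs_def)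
  qed
  then show ?thesis by blast
qed

section \<open>Comparison of coefficients\<close>

theorem theorem2p3:
  fixes D D1 D2 D3 :: "('a,'b) pre_digraph"
    and u v :: 'a and a1 a2 :: 'b and n m :: nat
  assumes "fin_digraph D"
    and "u \<in> verts D" and "v \<in> verts D" and "u \<noteq> v"
    and "arc_mult D u v = n" and "arc_mult D v u = m"
    and "D3 = del_arcs D (parallel_arcs D u v \<union> parallel_arcs D v u)"
    and "a1 \<notin> arcs D3" and "D1 = add_arc_between D3 a1 u v"
    and "a2 \<notin> arcs D3" and "D2 = add_arc_between D3 a2 v u"
  shows "cycle_poly D = of_nat n * cycle_poly D1 + of_nat m * cycle_poly D2
           - (of_nat n + of_nat m - 1) * cycle_poly D3 + monom (of_nat (n * m)) 2
       \<and> path_poly D = of_nat n * path_poly D1 + of_nat m * path_poly D2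
           - (of_nat n + of_nat m - 1) * path_poly D3"
proof -
  have wf: "wf_digraph D" using assms(1) by (simp add: fin_digraph_def)
  have fin3: "fin_digraph D3"
    unfolding assms(7) using assms(1) by (rule fin_digraph_del_arcs)
  have fin1: "fin_digraph D1" and fin2: "fin_digraph D2"
    unfolding assms(9,11) using fin3 assms(2,3)
    by (auto intro!: fin_digraph_add_arc_between simp: assms(7) del_arcs_def)
  \<comment> \<open>At \<open>k = 0\<close> all these coefficients are 0, although
    \<open>paths_of_length D 0\<close> contains the empty set, which stems from the empty
    walk.\<close>
  note coeff_polys = coeff_cycle_poly[OF assms(1)] coeff_cycle_poly[OF fin1]
    coeff_cycle_poly[OF fin2] coeff_cycle_poly[OF fin3]
    coeff_path_poly[OF assms(1)] coeff_path_poly[OF fin1]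
    coeff_path_poly[OF fin2] coeff_path_poly[OF fin3]
  \<comment> \<open>As a constant polynomial, the factor acts on coefficients by scalar
    multiplication.\<close>
  have const: "of_nat n + of_nat m - 1 = ([:int n + int m - 1:] :: int poly)"
    by (simp add: of_nat_poly one_pCons)
  have cycles: "int (card (cycles_of_length D k))
      = int n * int (card (cycles_of_length D1 k)) + int m * int (card (cycles_of_length D2 k))
      - (int n + int m - 1) * int (card (cycles_of_length D3 k)) + (if k = 2 then int (n * m) else 0)"
    for k
    using cycles.card_family_multiple_arcs[OF assms(1,4) refl refl assms(7-11), of k]
    unfolding card_cycles_opposite[OF wf assms(4)] arc_mult_def[symmetric] assms(5,6) by simp
  have paths: "int (card (paths_of_length D k))
      = int n * int (card (paths_of_length D1 k)) + int m * int (card (paths_of_length D2 k))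
      - (int n + int m - 1) * int (card (paths_of_length D3 k))"
    for k
    using paths.card_family_multiple_arcs[OF assms(1,4) refl refl assms(7-11), of k]
    unfolding paths_opposite_empty[OF wf] arc_mult_def[symmetric] assms(5,6) by simp
  show ?thesis
    unfolding const unfolding of_nat_poly poly_eq_iff
    using cycles paths by (simp add: coeff_polys)
qed

end
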